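(* The class of $K_{1,3}$-free graphs without a distance-$2$ packing of two cycles has unbounded tree-independence number.
   Context: Graphs are finite and simple. A graph is $K_{1,3}$-free if it has no induced subgraph isomorphic to $K_{1,3}$. A set $\mathcal{F}$ of cycles in $G$ is a distance-$2$ packing if any two distinct cycles of $\mathcal{F}$ have vertex sets at distance more than $2$ in $G$. A tree-decomposition of $G$ is a pair $(T,\beta)$ with $T$ a tree and $\beta:V(T)\to 2^{V(G)}$ such that every vertex lies in some bag, every edge has both ends in some bag, and for each vertex $v$ the nodes whose bags contain $v$ induce a subtree of $T$; its independence number is $\max_{u\in V(T)}\alpha(G[\beta(u)])$. The tree-independence number of $G$ is the minimum independence number over all tree-decompositions of $G$. *)

theory Defs
  imports "Graph_Theory.Graph_Theory"
begin

text \<open>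
  A finite simple graph is a digraph satisfying the locale \<open>graph\<close> of \<open>Graph_Theory\<close> (finite,
  loop-free, without parallel arcs, symmetric): an edge \<open>uv\<close> is the pair of arcs from \<open>u\<close> to \<open>v\<close> and
  from \<open>v\<close> to \<open>u\<close>.  Hence walking along an edge and back is a \<open>pre_digraph.cycle\<close> of length 2;
  the cycles of the undirected graph are those of length at least 3.  For the same reason the
  constants \<open>forest\<close> and \<open>tree\<close> of the library cannot be used here: no graph with an edge
  satisfies them.
\<close>

definition graph_cycle :: "('a,'b) pre_digraph \<Rightarrow> 'b awalk \<Rightarrow> bool" where
  "graph_cycle G p \<longleftrightarrow> pre_digraph.cycle G p \<and> 3 \<le> length p"

text \<open>Cycles as subgraphs, so that neither starting point nor orientation matters.\<close>

definition cycles_of :: "('a,'b) pre_digraph \<Rightarrow> ('a,'b) pre_digraph set" where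
  "cycles_of G = {C. subgraph C G \<and> (\<exists>p. graph_cycle G p \<and>
     verts C = tail G ` set p \<and>
     arcs C = {e \<in> arcs G. (tail G e, head G e) \<in> arc_to_ends G ` set p
                         \<or> (head G e, tail G e) \<in> arc_to_ends G ` set p})}"

definition K13_free :: "('a,'b) pre_digraph \<Rightarrow> bool" where
  "K13_free G \<longleftrightarrow> \<not> (\<exists>H. induced_subgraph H G \<and> complete_bipartite_digraph 1 3 H)"

text \<open>Distances are extended reals: \<open>\<infinity>\<close> between vertices in different components.\<close>

definition graph_dist :: "('a,'b) pre_digraph \<Rightarrow> 'a \<Rightarrow> 'a \<Rightarrow> ereal" where
  "graph_dist G u v = wf_digraph.\<mu> G (\<lambda>_. 1) u v"

definition set_dist :: "('a,'b) pre_digraph \<Rightarrow> 'a set \<Rightarrow> 'a set \<Rightarrow> ereal" where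
  "set_dist G X Y = (INF u\<in>X. INF v\<in>Y. graph_dist G u v)"

definition distance_packing :: "nat \<Rightarrow> ('a,'b) pre_digraph \<Rightarrow> ('a,'b) pre_digraph set \<Rightarrow> bool" where
  "distance_packing d G F \<longleftrightarrow> F \<subseteq> cycles_of G \<and>
     (\<forall>C\<in>F. \<forall>D\<in>F. C \<noteq> D \<longrightarrow> set_dist G (verts C) (verts D) > ereal (real d))"

definition is_tree :: "('a,'b) pre_digraph \<Rightarrow> bool" where
  "is_tree T \<longleftrightarrow> Digraph.graph T \<and> Digraph_Component.connected T \<and> \<not> (\<exists>p. graph_cycle T p)"

definition tree_decomposition ::
  "('a,'b) pre_digraph \<Rightarrow> ('t,'s) pre_digraph \<Rightarrow> ('t \<Rightarrow> 'a set) \<Rightarrow> bool" where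
  "tree_decomposition G T \<beta> \<longleftrightarrow> is_tree T \<and>
     (\<forall>t\<in>verts T. \<beta> t \<subseteq> verts G) \<and>
     (\<forall>v\<in>verts G. \<exists>t\<in>verts T. v \<in> \<beta> t) \<and>
     (\<forall>e\<in>arcs G. \<exists>t\<in>verts T. tail G e \<in> \<beta> t \<and> head G e \<in> \<beta> t) \<and>
     (\<forall>v\<in>verts G. is_tree (T \<restriction> {t \<in> verts T. v \<in> \<beta> t}))"

definition independent_set :: "('a,'b) pre_digraph \<Rightarrow> 'a set \<Rightarrow> bool" where
  "independent_set G S \<longleftrightarrow> S \<subseteq> verts G \<and> (\<forall>u\<in>S. \<forall>v\<in>S. (u, v) \<notin> arcs_ends G)"

definition independence_number :: "('a,'b) pre_digraph \<Rightarrow> nat" where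
  "independence_number G = Max (card ` {S. independent_set G S})"

definition td_independence_number ::
  "('a,'b) pre_digraph \<Rightarrow> ('t,'s) pre_digraph \<Rightarrow> ('t \<Rightarrow> 'a set) \<Rightarrow> nat" where
  "td_independence_number G T \<beta> = Max ((\<lambda>t. independence_number (G \<restriction> \<beta> t)) ` verts T)"

text \<open>
  Decomposition trees are finite, so up to isomorphism their nodes are natural numbers and their
  arcs are pairs of nodes.
\<close>

definition tree_independence_number :: "('a,'b) pre_digraph \<Rightarrow> nat" where
  "tree_independence_number G =
     (LEAST k. \<exists>(T :: (nat, nat \<times> nat) pre_digraph) \<beta>.
        tree_decomposition G T \<beta> \<and> td_independence_number G T \<beta> = k)"

end

theory Submission
  imports Defs
begin

text \<open>
  The witnesses are the \<open>n \<times> n\<close> rook's graphs (line graphs of complete bipartite graphs). The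
  neighbourhood of a square is a union of two cliques, so there is no induced claw, and any two
  squares are at distance at most 2, so no two cycles are further apart.  Deleting fewer than \<open>k\<close>
  rows and fewer than \<open>k\<close> columns leaves a connected set, and for \<open>n \<ge> 2k\<close> any two such remainders
  intersect; by the Helly property of subtrees some bag meets all of them.  If a largest
  independent set \<open>S\<close> of that bag had fewer than \<open>k\<close> elements, then the bag would meet the remainder
  after deleting the rows and columns of \<open>S\<close>, and \<open>S\<close> could be enlarged.
\<close>

section \<open>The Helly property of subtrees\<close>

text \<open>If every node \<open>t\<close> were missed by some member \<open>B t\<close>, that
  member would lie in one component of the tree minus \<open>t\<close>. Choose \<open>t\<close> with
  the smallest such component and step to its neighbour \<open>s\<close> inside: the component for
  \<open>s\<close> is then strictly smaller, or the edge between them lies on a cycle. The tree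
  enters only as a connected relation whose edges are bridges, so the argument handles reachability
  alone.\<close>

lemma Helly_connected_subsets:
  fixes E :: "('a \<times> 'a) set"
  assumes V: "finite V" "V \<noteq> {}" and E: "sym E" "E \<subseteq> V \<times> V"
    and conn: "\<And>x y. x \<in> V \<Longrightarrow> y \<in> V \<Longrightarrow> (x, y) \<in> E\<^sup>*"
    and bridge: "\<And>s t. (s, t) \<in> E \<Longrightarrow> (s, t) \<notin> (E - {(s, t), (t, s)})\<^sup>*"
    and sub: "\<And>S. S \<in> F \<Longrightarrow> S \<subseteq> V"
    and conn_F: "\<And>S x y. S \<in> F \<Longrightarrow> x \<in> S \<Longrightarrow> y \<in> S \<Longrightarrow> (x, y) \<in> (Restr E S)\<^sup>*"
    and inter: "\<And>S S'. S \<in> F \<Longrightarrow> S' \<in> F \<Longrightarrow> S \<inter> S' \<noteq> {}"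
  shows "\<exists>t\<in>V. \<forall>S\<in>F. t \<in> S"
proof (rule ccontr)
  assume "\<not> ?thesis"
  then have "\<forall>t\<in>V. \<exists>S. S \<in> F \<and> t \<notin> S" by blast
  then obtain B where B: "\<And>t. t \<in> V \<Longrightarrow> B t \<in> F" "\<And>t. t \<in> V \<Longrightarrow> t \<notin> B t"
    by metis
  have "\<forall>t\<in>V. \<exists>x. x \<in> B t" using inter B by blast
  then obtain r where r: "\<And>t. t \<in> V \<Longrightarrow> r t \<in> B t" by metis
  let ?R = "\<lambda>t. Restr E (- {t})"
  \<comment> \<open>\<open>C t\<close> is the component of the graph without \<open>t\<close> that contains \<open>B t\<close>.\<close>
  define C where "C t = {y. (r t, y) \<in> (?R t)\<^sup>*}" for t
  have symR: "sym ((?R t)\<^sup>*)" for t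
    using E(1) by (intro sym_rtrancl) (auto simp: sym_def)
  have BC: "B t \<subseteq> C t" if "t \<in> V" for t
  proof
    fix y assume "y \<in> B t"
    then have "(r t, y) \<in> (Restr E (B t))\<^sup>*" using conn_F B r that by blast
    moreover have "Restr E (B t) \<subseteq> ?R t" using B(2)[OF that] by blast
    ultimately have "(r t, y) \<in> (?R t)\<^sup>*" using rtrancl_mono by blast
    then show "y \<in> C t" by (simp add: C_def)
  qed
  have CV: "C t \<subseteq> V" and tC: "t \<notin> C t" if "t \<in> V" for t
  proof -
    have "y \<in> V \<and> y \<noteq> t" if "(r t, y) \<in> (?R t)\<^sup>*" for y
      using that
    proof induction
      case base
      have "r t \<in> V" using sub[OF B(1)] r \<open>t \<in> V\<close> by blast
      then show ?case using r B(2) \<open>t \<in> V\<close> by metis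
    qed (use E(2) in auto)
    then show "C t \<subseteq> V" "t \<notin> C t" by (auto simp: C_def)
  qed
  have C_path: "(x, y) \<in> (?R t)\<^sup>*" if "x \<in> C t" "y \<in> C t" for x y t
  proof (rule rtrancl_trans)
    show "(x, r t) \<in> (?R t)\<^sup>*" using symD[OF symR] that(1) by (simp add: C_def)
    show "(r t, y) \<in> (?R t)\<^sup>*" using that(2) by (simp add: C_def)
  qed
  have C_step: "y \<in> C t" if "x \<in> C t" "(x, y) \<in> ?R t" for x y t
    using rtrancl_into_rtrancl[OF _ that(2)] that(1) by (simp add: C_def)
  obtain t where t: "t \<in> V" and least: "\<And>s. s \<in> V \<Longrightarrow> card (C t) \<le> card (C s)"
    using ex_has_least_nat[of "\<lambda>t. t \<in> V" _ "\<lambda>t. card (C t)"] V(2) by blast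
  obtain s where s: "s \<in> C t" "(t, s) \<in> E"
  proof -
    \<comment> \<open>Follow a walk to \<open>r t\<close> backwards: it stays in \<open>C t\<close>
      until it steps onto \<open>t\<close>, and the vertex just visited is then the required
      neighbour. For \<open>y = t\<close> the first alternative is impossible.\<close>
    have "y \<in> C t \<or> (\<exists>s\<in>C t. (t, s) \<in> E)" if "(y, r t) \<in> E\<^sup>*" for y
      using that
    proof (induction rule: converse_rtrancl_induct)
      case base
      then show ?case by (simp add: C_def)
    next
      case (step y z)
      show ?case
      proof (cases "z \<in> C t \<and> y \<noteq> t")
        case True
        then have "(z, y) \<in> ?R t" using step(1) E(1) tC[OF t] by (auto simp: sym_def)
        then show ?thesis using True C_step by blast
      next
        case False
        then show ?thesis using step by blast
      qed
    qed
    moreover have "(t, r t) \<in> E\<^sup>*" using conn t r B sub by blast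
    ultimately show thesis using that tC[OF t] by blast
  qed
  have sV: "s \<in> V" using s CV t by blast
  obtain x where "x \<in> B t" "x \<in> B s" using inter B t sV by blast
  then have x: "x \<in> C t" "x \<in> C s" using BC t sV by auto
  show False
  proof (cases "t \<in> C s")
    case True
    \<comment> \<open>The walk from \<open>s\<close> to \<open>x\<close> avoids \<open>t\<close> and
      the walk from \<open>x\<close> to \<open>t\<close> avoids \<open>s\<close>, so neither uses
      the edge between \<open>s\<close> and \<open>t\<close>, which is therefore no bridge.\<close>
    let ?E = "E - {(s, t), (t, s)}"
    have "(s, x) \<in> (?R t)\<^sup>*" "(x, t) \<in> (?R s)\<^sup>*"
      using C_path s(1) x True by auto
    moreover have "?R t \<subseteq> ?E" "?R s \<subseteq> ?E" by auto
    ultimately have "(s, x) \<in> ?E\<^sup>*" "(x, t) \<in> ?E\<^sup>*" using rtrancl_mono by blast+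
    moreover have "(s, t) \<in> E" using s(2) E(1) by (auto simp: sym_def)
    ultimately show False using bridge[of s t] by (meson rtrancl_trans)
  next
    case False
    \<comment> \<open>A walk from \<open>x\<close> avoiding \<open>s\<close> stays in
      \<open>C s\<close>, hence never meets \<open>t\<close> and cannot leave \<open>C t\<close>.
      Since \<open>s\<close> is in \<open>C t\<close> but not in \<open>C s\<close>, the inclusion
      is strict, against the choice of \<open>t\<close>.\<close>
    have "y \<in> C t" if "(x, y) \<in> (?R s)\<^sup>*" for y
      using that
    proof induction
      case (step y z)
      have "(x, z) \<in> (?R s)\<^sup>*" using step(1,2) by (rule rtrancl_into_rtrancl)
      moreover have "(r s, x) \<in> (?R s)\<^sup>*" using x(2) by (simp add: C_def)
      ultimately have "z \<in> C s" unfolding C_def by (simp add: rtrancl_trans)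
      then show ?case
        using C_step[OF step(3), of z] step tC[OF t] False by auto
    qed (fact x(1))
    then have "C s \<subseteq> C t" using C_path x(2) by blast
    then have "C s \<subset> C t" using s(1) tC[OF sV] by blast
    then have "card (C s) < card (C t)"
      using CV[OF t] V(1) by (meson finite_subset psubset_card_mono)
    then show False using least[OF sV] by simp
  qed
qed

section \<open>Trees as connected relations whose edges are bridges\<close>

lemma (in wf_digraph) rtrancl_imp_awalk:
  assumes "(u, v) \<in> R\<^sup>*" "R \<subseteq> arcs_ends G" "u \<in> verts G"
  shows "\<exists>p. awalk u p v \<and> arc_to_ends G ` set p \<subseteq> R"
  using assms(1)
proof induction
  case base
  show ?case using assms(3) by (intro exI[of _ "[]"]) (simp add: awalk_Nil_iff)
next
  case (step v w)
  then obtain p where p: "awalk u p v" "arc_to_ends G ` set p \<subseteq> R" by blast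
  obtain e where e: "e \<in> arcs G" "arc_to_ends G e = (v, w)"
    using step(2) assms(2) by (auto simp: arcs_ends_def)
  then have "awalk v [e] w" by (auto simp: awalk_simps arc_to_ends_def)
  with p(1) have "awalk u (p @ [e]) w" by (auto simp: awalk_append_iff)
  then show ?case using p(2) e step(2) by (intro exI[of _ "p @ [e]"]) auto
qed

text \<open>A path from \<open>s\<close> to \<open>t\<close> that avoids the edge would close up
  with it to a cycle.\<close>

lemma tree_edge_bridge:
  assumes T: "is_tree T" and st: "(s, t) \<in> arcs_ends T"
  shows "(s, t) \<notin> (arcs_ends T - {(s, t), (t, s)})\<^sup>*" (is "_ \<notin> ?R\<^sup>*")
proof
  interpret graph T using T by (simp add: is_tree_def)
  assume "(s, t) \<in> ?R\<^sup>*"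
  moreover have "s \<in> verts T" using st by auto
  ultimately obtain p where p: "awalk s p t" "arc_to_ends T ` set p \<subseteq> ?R"
    using rtrancl_imp_awalk by blast
  let ?q = "awalk_to_apath p"
  have q: "apath s ?q t" "set ?q \<subseteq> set p"
    using p(1) by (rule apath_awalk_to_apath, rule awalk_to_apath_subset)
  obtain e where e: "e \<in> arcs T" "tail T e = t" "head T e = s"
    using st sym_arcs by (metis arcs_ends_symmetric reachableE)
  have "s \<noteq> t" using st adj_not_same by blast
  \<comment> \<open>A single arc from \<open>s\<close> to \<open>t\<close> was removed from the
    relation. With \<open>e\<close> added the closed walk then has at least 3 arcs, so it is not
    just an edge walked back and forth.\<close>
  have len: "2 \<le> length ?q"
  proof (rule ccontr)
    assume "\<not> ?thesis"
    then consider "?q = []" | a where "?q = [a]"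
      by (metis One_nat_def Suc_1 length_0_conv length_Suc_conv less_2_cases not_le)
    then show False
    proof cases
      case 1
      then show False using q(1) \<open>s \<noteq> t\<close> by (simp add: apath_Nil_iff)
    next
      case 2
      then have "arc_to_ends T a = (s, t)"
        using q(1) by (auto simp: apath_simps arc_to_ends_def)
      moreover have "a \<in> set p" using q(2) 2 by simp
      ultimately show False using p(2) by auto
    qed
  qed
  \<comment> \<open>Starting at \<open>t\<close> makes the vertices after the first exactly those of
    the path \<open>?q\<close>, which are distinct.\<close>
  have "cycle (e # ?q)"
    unfolding cycle_def using q(1) e
    by (intro exI[of _ t]) (auto simp: awalk_Cons_iff apath_def)
  then have "graph_cycle T (e # ?q)" using len by (simp add: graph_cycle_def)
  then show False using T by (auto simp: is_tree_def)
qed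

lemma is_tree_reachable:
  assumes "is_tree T" "x \<in> verts T" "y \<in> verts T"
  shows "(x, y) \<in> (arcs_ends T)\<^sup>*"
proof -
  interpret graph T using assms by (simp add: is_tree_def)
  have "strongly_connected T"
    using assms(1) symmetric_connected_imp_strongly_connected by (auto simp: is_tree_def)
  then have "x \<rightarrow>\<^sup>*\<^bsub>T\<^esub> y" using assms(2,3) by auto
  then show ?thesis by (simp add: reachable_conv)
qed

section \<open>Brambles and tree-decompositions\<close>

lemma tree_decomposition_nodes_connected:
  assumes td: "tree_decomposition G T \<beta>" and v: "v \<in> verts G"
    and x: "x \<in> verts T" "v \<in> \<beta> x" and y: "y \<in> verts T" "v \<in> \<beta> y"
  shows "(x, y) \<in> (Restr (arcs_ends T) {t \<in> verts T. v \<in> \<beta> t})\<^sup>*"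
proof -
  let ?S = "{t \<in> verts T. v \<in> \<beta> t}"
  have "is_tree (T \<restriction> ?S)" using td v by (simp add: tree_decomposition_def)
  then have "(x, y) \<in> (arcs_ends (T \<restriction> ?S))\<^sup>*"
    using x y by (intro is_tree_reachable) auto
  moreover have "arcs_ends (T \<restriction> ?S) \<subseteq> Restr (arcs_ends T) ?S"
    by (auto simp: arcs_ends_conv)
  ultimately show ?thesis using rtrancl_mono by blast
qed

text \<open>Each vertex of \<open>B\<close> occupies a connected set of nodes, and the sets of two
  adjacent vertices share the node whose bag holds the edge; a walk in \<open>B\<close> chains them
  together.\<close>

lemma tree_decomposition_meeting_connected:
  assumes td: "tree_decomposition G T \<beta>" and B: "B \<subseteq> verts G"
    and conn: "\<And>u v. u \<in> B \<Longrightarrow> v \<in> B \<Longrightarrow> (u, v) \<in> (Restr (arcs_ends G) B)\<^sup>*"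
    and x: "x \<in> verts T" "\<beta> x \<inter> B \<noteq> {}" and y: "y \<in> verts T" "\<beta> y \<inter> B \<noteq> {}"
  shows "(x, y) \<in> (Restr (arcs_ends T) {t \<in> verts T. \<beta> t \<inter> B \<noteq> {}})\<^sup>*" (is "_ \<in> ?R\<^sup>*")
proof -
  obtain u v where u: "u \<in> \<beta> x" "u \<in> B" and v: "v \<in> \<beta> y" "v \<in> B" using x y by blast
  have same: "(a, b) \<in> ?R\<^sup>*"
    if "w \<in> B" "a \<in> verts T" "w \<in> \<beta> a" "b \<in> verts T" "w \<in> \<beta> b" for w a b
  proof -
    have "(a, b) \<in> (Restr (arcs_ends T) {t \<in> verts T. w \<in> \<beta> t})\<^sup>*"
      using tree_decomposition_nodes_connected[OF td] that B by blast
    moreover have "Restr (arcs_ends T) {t \<in> verts T. w \<in> \<beta> t} \<subseteq> ?R" using that(1) by auto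
    ultimately show ?thesis using rtrancl_mono by blast
  qed
  \<comment> \<open>The claim covers all nodes of the current vertex, so that it applies to the node
    \<open>z\<close> holding the next edge.\<close>
  have "\<forall>y. y \<in> verts T \<and> v \<in> \<beta> y \<longrightarrow> (x, y) \<in> ?R\<^sup>*"
    using conn[OF u(2) v(2)]
  proof induction
    case base
    then show ?case using same u x by blast
  next
    case (step v w)
    then obtain z where z: "z \<in> verts T" "v \<in> \<beta> z" "w \<in> \<beta> z"
      using td unfolding tree_decomposition_def by (auto simp: arcs_ends_conv)
    show ?case using step z same by (blast intro: rtrancl_trans)
  qed
  then show ?thesis using y v by blast
qed

text \<open>Members of this bramble intersect instead of merely touching, so a bag containing a
  common vertex is a common node of their traces in the tree. The traces are connected, and the
  Helly property applies.\<close>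

lemma tree_decomposition_bag_meets_bramble:
  assumes td: "tree_decomposition G T \<beta>"
    and sub: "\<And>B. B \<in> \<B> \<Longrightarrow> B \<subseteq> verts G"
    and conn: "\<And>B u v. B \<in> \<B> \<Longrightarrow> u \<in> B \<Longrightarrow> v \<in> B \<Longrightarrow> (u, v) \<in> (Restr (arcs_ends G) B)\<^sup>*"
    and inter: "\<And>B B'. B \<in> \<B> \<Longrightarrow> B' \<in> \<B> \<Longrightarrow> B \<inter> B' \<noteq> {}"
  shows "\<exists>t\<in>verts T. \<forall>B\<in>\<B>. \<beta> t \<inter> B \<noteq> {}"
proof -
  have T: "is_tree T" using td by (simp add: tree_decomposition_def)
  then interpret graph T by (simp add: is_tree_def)
  let ?N = "\<lambda>B. {t \<in> verts T. \<beta> t \<inter> B \<noteq> {}}"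
  have "\<exists>t\<in>verts T. \<forall>S\<in>?N ` \<B>. t \<in> S"
  proof (rule Helly_connected_subsets[where E = "arcs_ends T"])
    show "verts T \<noteq> {}"
      using T by (simp add: is_tree_def connected_conv)
    show "sym (arcs_ends T)" using sym_arcs by (simp add: symmetric_def)
    show "arcs_ends T \<subseteq> verts T \<times> verts T" by auto
    show "(x, y) \<in> (Restr (arcs_ends T) S)\<^sup>*" if "S \<in> ?N ` \<B>" "x \<in> S" "y \<in> S" for S x y
      using that tree_decomposition_meeting_connected[OF td sub conn] by auto
    show "S \<inter> S' \<noteq> {}" if SS: "S \<in> ?N ` \<B>" "S' \<in> ?N ` \<B>" for S S'
    proof -
      obtain B B' where B: "B \<in> \<B>" "B' \<in> \<B>" "S = ?N B" "S' = ?N B'" using SS by blast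
      then obtain v where v: "v \<in> B" "v \<in> B'" using inter by blast
      then obtain t where "t \<in> verts T" "v \<in> \<beta> t"
        using td sub B unfolding tree_decomposition_def by blast
      then show ?thesis using v B by blast
    qed
  qed (use T in \<open>auto simp: is_tree_reachable tree_edge_bridge\<close>)
  then show ?thesis by auto
qed

section \<open>From bags to the tree-independence number\<close>

lemma trivial_tree_decomposition:
  assumes "wf_digraph G"
  shows "\<exists>(T :: (nat, nat \<times> nat) pre_digraph) \<beta>. tree_decomposition G T \<beta>"
proof -
  interpret wf_digraph G by fact
  \<comment> \<open>A single bag with all vertices shows that the \<open>LEAST\<close> in
    \<open>tree_independence_number\<close> ranges over a non-empty set and is attained.\<close>
  let ?T = "\<lparr>verts = {0}, arcs = {}, tail = fst, head = snd\<rparr> :: (nat, nat \<times> nat) pre_digraph"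
  have graph: "Digraph.graph ?T"
    by unfold_locales (auto simp: symmetric_def arcs_ends_def sym_def)
  have "\<not> graph_cycle ?T p" for p
    by (auto simp: graph_cycle_def pre_digraph.cycle_def pre_digraph.awalk_def)
  moreover have "Digraph_Component.connected ?T"
    by (auto simp: connected_conv)
  ultimately have "is_tree ?T" using graph by (simp add: is_tree_def)
  moreover from this have "is_tree (?T \<restriction> {0})" by (simp add: induce_subgraph_def)
  ultimately have "tree_decomposition G ?T (\<lambda>_. verts G)"
    by (simp add: tree_decomposition_def)
  then show ?thesis by blast
qed

lemma tree_independence_number_geI:
  assumes "wf_digraph G"
    and "\<And>(T :: (nat, nat \<times> nat) pre_digraph) \<beta>. tree_decomposition G T \<beta> \<Longrightarrow>
      \<exists>t\<in>verts T. k \<le> independence_number (G \<restriction> \<beta> t)"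
  shows "k \<le> tree_independence_number G"
proof -
  have "\<exists>(T :: (nat, nat \<times> nat) pre_digraph) \<beta>.
      tree_decomposition G T \<beta> \<and> td_independence_number G T \<beta> = tree_independence_number G"
    unfolding tree_independence_number_def
    by (rule LeastI_ex) (use trivial_tree_decomposition[OF assms(1)] in blast)
  then obtain T :: "(nat, nat \<times> nat) pre_digraph" and \<beta>
    where T: "tree_decomposition G T \<beta>"
      and eq: "td_independence_number G T \<beta> = tree_independence_number G" by blast
  interpret graph T using T by (simp add: tree_decomposition_def is_tree_def)
  obtain t where t: "t \<in> verts T" "k \<le> independence_number (G \<restriction> \<beta> t)"
    using assms(2)[OF T] by blast
  then have "independence_number (G \<restriction> \<beta> t) \<le> td_independence_number G T \<beta>"
    unfolding td_independence_number_def by (intro Max_ge) auto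
  then show ?thesis using t eq by simp
qed

section \<open>Largest independent sets in finite graphs\<close>

lemma finite_independent_sets:
  assumes "finite (verts G)"
  shows "finite {S. independent_set G S}"
  using assms by (auto simp: independent_set_def intro: finite_subset[of _ "Pow (verts G)"])

lemma maximum_independent_setE:
  assumes "finite (verts G)"
  obtains S where "independent_set G S" "card S = independence_number G"
proof -
  have "independent_set G {}" by (simp add: independent_set_def)
  then have "independence_number G \<in> card ` {S. independent_set G S}"
    unfolding independence_number_def
    by (intro Max_in finite_imageI finite_independent_sets assms) auto
  then show thesis using that by auto
qed

lemma card_le_independence_number:
  assumes "finite (verts G)" "independent_set G S"
  shows "card S \<le> independence_number G"
  unfolding independence_number_def
  by (intro Max_ge finite_imageI finite_independent_sets) (use assms in auto)

section \<open>Rook's graphs\<close>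

text \<open>The square in row \<open>i\<close> and column \<open>j\<close> is the vertex \<open>i * n + j\<close>.\<close>

definition rook_graph :: "nat \<Rightarrow> (nat, nat \<times> nat) pre_digraph" where
  "rook_graph n = \<lparr>verts = {..<n * n},
     arcs = {(u, v). u < n * n \<and> v < n * n \<and> u \<noteq> v \<and> (u div n = v div n \<or> u mod n = v mod n)},
     tail = fst, head = snd\<rparr>"

lemma rook_square:
  fixes i j n :: nat
  assumes "i < n" "j < n"
  shows "i * n + j < n * n" "(i * n + j) div n = i" "(i * n + j) mod n = j"
proof -
  have "i * n + j < Suc i * n" using assms(2) by simp
  also have "\<dots> \<le> n * n" using assms(1) by (intro mult_le_mono1) simp
  finally show "i * n + j < n * n" .
qed (use assms in auto)

lemma verts_rook_graph [simp]: "verts (rook_graph n) = {..<n * n}"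
  by (simp add: rook_graph_def)

lemma arcs_ends_rook_graph:
  "(u, v) \<in> arcs_ends (rook_graph n) \<longleftrightarrow>
     u < n * n \<and> v < n * n \<and> u \<noteq> v \<and> (u div n = v div n \<or> u mod n = v mod n)"
  by (force simp: rook_graph_def arcs_ends_conv)

lemma graph_rook_graph: "Digraph.graph (rook_graph n)"
proof -
  have "arcs (rook_graph n) \<subseteq> {..<n * n} \<times> {..<n * n}" by (auto simp: rook_graph_def)
  then have "finite (arcs (rook_graph n))" by (rule finite_subset) simp
  moreover have "symmetric (rook_graph n)"
    by (auto simp: symmetric_def sym_def arcs_ends_rook_graph)
  ultimately show ?thesis
    by unfold_locales (auto simp: rook_graph_def arc_to_ends_def)
qed

lemma K13_free_rook_graph: "K13_free (rook_graph n)"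
  unfolding K13_free_def
proof
  assume "\<exists>H. induced_subgraph H (rook_graph n) \<and> complete_bipartite_digraph 1 3 H"
  then obtain H U V where H: "induced_subgraph H (rook_graph n)" "verts H = U \<union> V"
    "U \<inter> V = {}" "card U = 1" "card V = 3" "arcs_ends H = U \<times> V \<union> V \<times> U"
    by (auto simp: complete_bipartite_digraph_def)
  obtain c where c: "U = {c}" using H(4) by (auto simp: card_1_singleton_iff)
  obtain x y z where V: "V = {x, y, z}" "x \<noteq> y" "x \<noteq> z" "y \<noteq> z"
    using H(5) by (auto simp: card_3_iff)
  \<comment> \<open>Inducedness makes non-adjacency of the leaves in \<open>H\<close> carry over to
    the rook's graph.\<close>
  have arcs: "arcs_ends H = Restr (arcs_ends (rook_graph n)) (verts H)"
    using H(1)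
    by (force simp: induced_subgraph_def subgraph_def compatible_def arcs_ends_conv)
  have adj: "(c, w) \<in> arcs_ends (rook_graph n)" if "w \<in> V" for w
    using arcs H(6) c that by blast
  have "(v, w) \<notin> arcs_ends (rook_graph n)" if "v \<in> V" "w \<in> V" for v w
  proof
    assume "(v, w) \<in> arcs_ends (rook_graph n)"
    then have "(v, w) \<in> arcs_ends H" unfolding arcs using that H(2) by simp
    then show False unfolding H(6) using that H(3) by auto
  qed
  then have distinct: "v div n \<noteq> w div n \<and> v mod n \<noteq> w mod n" if "v \<in> V" "w \<in> V" "v \<noteq> w" for v w
    using that adj[of v] adj[of w] unfolding arcs_ends_rook_graph by blast
  have "w div n = c div n \<or> w mod n = c mod n" if "w \<in> V" for w
    using adj[OF that] by (auto simp: arcs_ends_rook_graph)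
  \<comment> \<open>Pigeonhole: each of the three leaves shares the row or the column of
    \<open>c\<close>, so two of them share the same line.\<close>
  then show False
    using distinct V by (metis insertCI)
qed

section \<open>Distances and packings in rook's graphs\<close>

lemma graph_dist_rook_graph_le:
  assumes "u < n * n" "v < n * n"
  shows "graph_dist (rook_graph n) u v \<le> 2"
proof -
  interpret graph "rook_graph n" by (rule graph_rook_graph)
  \<comment> \<open>Length 0 is allowed because the corner square \<open>?w\<close> below, in the
    row of \<open>u\<close> and the column of \<open>v\<close>, may equal \<open>u\<close> or
    \<open>v\<close>.\<close>
  have walk: "\<exists>p. awalk a p b \<and> length p \<le> 1"
    if "a < n * n" "b < n * n" "a div n = b div n \<or> a mod n = b mod n" for a b
  proof (cases "a = b")
    case True
    then show ?thesis using that by (intro exI[of _ "[]"]) (simp add: awalk_simps)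
  next
    case False
    then have "awalk a [(a, b)] b"
      using that by (simp add: awalk_simps) (simp add: rook_graph_def)
    then show ?thesis by (intro exI[of _ "[(a, b)]"]) simp
  qed
  let ?w = "u div n * n + v mod n"
  have n: "0 < n" using assms by (cases n) auto
  have "u div n < n" using assms by (simp add: less_mult_imp_div_less)
  then have w: "?w < n * n" "?w div n = u div n" "?w mod n = v mod n"
    using n by (simp_all add: rook_square)
  obtain p q where "awalk u p ?w" "length p \<le> 1" "awalk ?w q v" "length q \<le> 1"
    using walk[of u ?w] walk[of ?w v] w assms by auto
  then have pq: "awalk u (p @ q) v" "length (p @ q) \<le> 2" by auto
  have "graph_dist (rook_graph n) u v \<le> awalk_cost (\<lambda>_. 1) (p @ q)"
    unfolding graph_dist_def by (rule min_cost_le_walk_cost[OF pq(1)])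
  also have "awalk_cost (\<lambda>_. 1) (p @ q) = real (length (p @ q))"
    by (simp add: awalk_cost_def sum_list_triv)
  also have "ereal (real (length (p @ q))) \<le> 2"
    using pq(2) by (simp del: length_append)
  finally show ?thesis .
qed

lemma no_distance_packing_rook_graph:
  "\<not> (\<exists>F. distance_packing 2 (rook_graph n) F \<and> card F = 2)"
proof
  assume "\<exists>F. distance_packing 2 (rook_graph n) F \<and> card F = 2"
  then obtain C D where CD: "C \<in> cycles_of (rook_graph n)" "D \<in> cycles_of (rook_graph n)"
    and far: "set_dist (rook_graph n) (verts C) (verts D) > ereal (real 2)"
    by (auto simp: distance_packing_def card_2_iff)
  \<comment> \<open>The infimum in \<open>set_dist\<close> over an empty set would be \<infinity>,
    so each cycle must supply a vertex.\<close>
  have "\<exists>u. u \<in> verts X \<and> u < n * n" if X: "X \<in> cycles_of (rook_graph n)" for X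
  proof -
    obtain p where "subgraph X (rook_graph n)" "graph_cycle (rook_graph n) p"
      "verts X = tail (rook_graph n) ` set p"
      using X unfolding cycles_of_def by blast
    then have "verts X \<subseteq> {..<n * n}" "verts X \<noteq> {}"
      by (auto simp: subgraph_def graph_cycle_def)
    then show ?thesis by auto
  qed
  then obtain u v where uv: "u \<in> verts C" "u < n * n" "v \<in> verts D" "v < n * n"
    using CD by blast
  have "set_dist (rook_graph n) (verts C) (verts D) \<le> graph_dist (rook_graph n) u v"
    unfolding set_dist_def using uv by (intro INF_lower2[of u] INF_lower2[of v]) auto
  also have "\<dots> \<le> 2" using uv by (intro graph_dist_rook_graph_le)
  finally show False using far by (simp add: not_less[symmetric])
qed

lemma tree_independence_number_rook_graph:
  assumes k: "2 * k \<le> n" "0 < k"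
  shows "k \<le> tree_independence_number (rook_graph n)"
proof (rule tree_independence_number_geI)
  interpret graph "rook_graph n" by (rule graph_rook_graph)
  show "wf_digraph (rook_graph n)" by (rule wf_digraph)
  fix T :: "(nat, nat \<times> nat) pre_digraph" and \<beta>
  assume td: "tree_decomposition (rook_graph n) T \<beta>"
  have n: "0 < n" using k by simp
  define B where "B I J = {v. v < n * n \<and> v div n \<notin> I \<and> v mod n \<notin> J}" for I J
  define small where "small I \<longleftrightarrow> finite I \<and> card I < k" for I :: "nat set"
  \<comment> \<open>Two small sets have together fewer than \<open>2 * k\<close> elements, hence
    fewer than \<open>n\<close>. This serves rows and columns alike and yields a common square of
    any two members.\<close>
  have fresh: "\<exists>i<n. i \<notin> I \<and> i \<notin> I'" if "small I" "small I'" for I I'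
  proof -
    have "card (I \<union> I') < card {..<n}"
      using that k card_Un_le[of I I'] by (simp add: small_def)
    then have "\<not> {..<n} \<subseteq> I \<union> I'"
      using that by (metis card_mono finite_UnI leD small_def)
    then show ?thesis by auto
  qed
  have "\<exists>t\<in>verts T. \<forall>A\<in>{B I J |I J. small I \<and> small J}. \<beta> t \<inter> A \<noteq> {}"
  proof (rule tree_decomposition_bag_meets_bramble[OF td])
    show "A \<subseteq> verts (rook_graph n)" if "A \<in> {B I J |I J. small I \<and> small J}" for A
      using that by (auto simp: B_def)
    show "A \<inter> A' \<noteq> {}"
      if AA: "A \<in> {B I J |I J. small I \<and> small J}" "A' \<in> {B I J |I J. small I \<and> small J}" for A A'
    proof -
      obtain I J I' J' where A: "A = B I J" "A' = B I' J'" "small I" "small J" "small I'" "small J'"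
        using AA by blast
      obtain i j where "i < n" "i \<notin> I" "i \<notin> I'" "j < n" "j \<notin> J" "j \<notin> J'"
        using fresh A by metis
      then have "i * n + j \<in> A \<inter> A'" by (simp add: A B_def rook_square)
      then show ?thesis by blast
    qed
    show "(u, v) \<in> (Restr (arcs_ends (rook_graph n)) A)\<^sup>*"
      if A: "A \<in> {B I J |I J. small I \<and> small J}" and uv: "u \<in> A" "v \<in> A" for A u v
    proof -
      obtain I J where AB: "A = B I J" using A by blast
      \<comment> \<open>The corner combines a row outside \<open>I\<close> with a column outside
        \<open>J\<close>, so the walk from \<open>u\<close> through it to \<open>v\<close> stays in
        \<open>A\<close>.\<close>
      let ?w = "u div n * n + v mod n"
      have "u div n < n" using uv by (simp add: AB B_def less_mult_imp_div_less)
      then have w: "?w < n * n" "?w div n = u div n" "?w mod n = v mod n"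
        using n by (simp_all add: rook_square)
      have wA: "?w \<in> A" using w uv by (simp add: AB B_def)
      have "(a, b) \<in> (Restr (arcs_ends (rook_graph n)) A)\<^sup>*"
        if "a \<in> A" "b \<in> A" "a div n = b div n \<or> a mod n = b mod n" for a b
        using that by (cases "a = b") (auto simp: arcs_ends_rook_graph AB B_def)
      then have "(u, ?w) \<in> (Restr (arcs_ends (rook_graph n)) A)\<^sup>*"
        "(?w, v) \<in> (Restr (arcs_ends (rook_graph n)) A)\<^sup>*"
        using uv wA w by auto
      then show ?thesis by (rule rtrancl_trans)
    qed
  qed
  then obtain t where t: "t \<in> verts T"
    and bag: "\<forall>A\<in>{B I J |I J. small I \<and> small J}. \<beta> t \<inter> A \<noteq> {}" by (rule bexE)
  have meets: "\<beta> t \<inter> B I J \<noteq> {}" if "small I" "small J" for I J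
    using bag that by blast
  have "\<beta> t \<subseteq> {..<n * n}" using td t by (auto simp: tree_decomposition_def)
  then have fin: "finite (verts (rook_graph n \<restriction> \<beta> t))" by (auto intro: finite_subset)
  have "k \<le> independence_number (rook_graph n \<restriction> \<beta> t)"
  proof (rule ccontr)
    assume less: "\<not> ?thesis"
    obtain S where S: "independent_set (rook_graph n \<restriction> \<beta> t) S"
      "card S = independence_number (rook_graph n \<restriction> \<beta> t)"
      using maximum_independent_setE[OF fin] by blast
    have finS: "finite S" using S(1) fin by (auto simp: independent_set_def intro: finite_subset)
    \<comment> \<open>Applied to the row map and the column map: both images have at most
      \<open>card S\<close> elements, which is less than \<open>k\<close>.\<close>
    have "small (f ` S)" for f
      using finS less S(2) card_image_le[OF finS, of f] by (simp add: small_def)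
    then obtain v where v: "v \<in> \<beta> t" "v \<in> B ((\<lambda>u. u div n) ` S) ((\<lambda>u. u mod n) ` S)"
      using meets by blast
    \<comment> \<open>Sharing no row or column with \<open>S\<close>, the square \<open>v\<close>
      can be added to it; the case \<open>u = v\<close> only says that there are no loops.\<close>
    have non_adj: "(v, u) \<notin> arcs_ends (rook_graph n) \<and> (u, v) \<notin> arcs_ends (rook_graph n)"
      if "u \<in> insert v S" for u
    proof (cases "u = v")
      case False
      then have "u div n \<in> (\<lambda>u. u div n) ` S" "u mod n \<in> (\<lambda>u. u mod n) ` S"
        using that by auto
      then have "u div n \<noteq> v div n" "u mod n \<noteq> v mod n" using v(2) by (auto simp: B_def)
      then show ?thesis by (simp add: arcs_ends_rook_graph)
    qed (simp add: arcs_ends_rook_graph)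
    have "independent_set (rook_graph n \<restriction> \<beta> t) (insert v S)"
      unfolding independent_set_def
    proof (intro conjI ballI)
      show "insert v S \<subseteq> verts (rook_graph n \<restriction> \<beta> t)"
        using S(1) v(1) by (simp add: independent_set_def)
      fix a b assume ab: "a \<in> insert v S" "b \<in> insert v S"
      show "(a, b) \<notin> arcs_ends (rook_graph n \<restriction> \<beta> t)"
      proof (cases "a = v \<or> b = v")
        case True
        then have "(a, b) \<notin> arcs_ends (rook_graph n)" using non_adj ab by metis
        then show ?thesis using dominates_induce_subgraphD by metis
      next
        case False
        then show ?thesis using S(1) ab by (simp add: independent_set_def)
      qed
    qed
    from card_le_independence_number[OF fin this] have "card (insert v S) \<le> card S"
      using S(2) by simp
    moreover have "v \<notin> S" using v(2) by (auto simp: B_def)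
    ultimately show False using finS by simp
  qed
  then show "\<exists>t\<in>verts T. k \<le> independence_number (rook_graph n \<restriction> \<beta> t)" using t by blast
qed

theorem theorem1p8:
  shows "\<not> bdd_above (tree_independence_number `
    {G :: (nat, nat \<times> nat) pre_digraph.
       Digraph.graph G \<and> K13_free G \<and> \<not> (\<exists>F. distance_packing 2 G F \<and> card F = 2)})"
    (is "\<not> bdd_above (_ ` ?\<G>)")
proof
  assume "bdd_above (tree_independence_number ` ?\<G>)"
  then obtain M where M: "\<And>G. G \<in> ?\<G> \<Longrightarrow> tree_independence_number G \<le> M"
    by (meson bdd_above.unfold image_eqI)
  \<comment> \<open>With \<open>k = Suc M\<close> and \<open>n = 2 * k\<close> the lower bound
    exceeds \<open>M\<close>.\<close>
  have "rook_graph (2 * Suc M) \<in> ?\<G>"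
    using graph_rook_graph K13_free_rook_graph no_distance_packing_rook_graph by simp
  from M[OF this] tree_independence_number_rook_graph[of "Suc M" "2 * Suc M"]
  show False by simp
qed

end
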